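(* Let $h\in C^2(\mathbb{R}^n)$ and $\mu>0$. Let $f:\mathbb{R}^n\to\mathbb{R}$, $f(x)=h(x)+\mu\|x\|_1$, and $F:\mathbb{R}^n\times\mathbb{R}^n\to\mathbb{R}$, $F(a,b)=h(a^2-b^2)+\mu\sum_{i=1}^n(a_i^2+b_i^2)$. Let $(a^*,b^* )$ be a second-order stationary point of $F$, and let $s^*=(a^* )^2-(b^* )^2$. Assume that $f$ satisfies the KL property at $s^*$ with exponent $\alpha\in(0,1)$. If $-\nabla h(s^* )\in\mathrm{ri}(\mu\,\partial\|s^*\|_1)$, then $F$ satisfies the KL property at $(a^*,b^* )$ with exponent $\max\{\alpha,\frac12\}$.
   Context: For $a\in\mathbb{R}^n$, $a^2$ denotes the componentwise square. $\mathrm{ri}$ denotes the relative interior of a convex set and $\partial\|s\|_1$ the convex subdifferential of the $\ell_1$-norm at $s$. A second-order stationary point of $F$ is a point $(a,b)$ with $\nabla F(a,b)=0$ and $\nabla^2F(a,b)\succeq 0$. KL property with exponent: for a proper closed function $g:\mathbb{R}^m\to\mathbb{R}\cup\{\infty\}$, $\partial g$ denotes the limiting subdifferential (equal to $\{\nabla g(x)\}$ if $g$ is $C^1$, and to $\nabla g_1+\partial g_2$ if $g=g_1+g_2$ with $g_1\in C^1$ and $g_2$ proper closed convex). The function $g$ satisfies the Kurdyka-Łojasiewicz (KL) property at $\bar x$ (with $\partial g(\bar x)\ne\emptyset$) with exponent $\alpha\in[0,1)$ if there exist $\bar c>0$, $r\in(0,\infty]$ and a neighborhood $V$ of $\bar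 x$ such that for every $x\in V$ with $0<g(x)-g(\bar x)<r$ one has $\bar c(1-\alpha)\,(g(x)-g(\bar x))^{-\alpha}\,\mathrm{dist}(0,\partial g(x))\ge 1$, where $\mathrm{dist}$ is Euclidean distance and $\mathrm{dist}(0,\emptyset)=\infty$. *)

theory Defs
  imports "HOL-Analysis.Analysis"
begin

section \<open>Gradient, Hessian, twice continuous differentiability\<close>

text \<open>The gradient and the Hessian are only meaningful where the derivatives exist;
  the Hessian is represented as the linear map \<open>v \<mapsto> \<nabla>\<^sup>2g(x) v\<close>.\<close>

definition gradient :: "('a::euclidean_space \<Rightarrow> real) \<Rightarrow> 'a \<Rightarrow> 'a" where
  "gradient g x = (THE D. GDERIV g x :> D)"

definition hessian :: "('a::euclidean_space \<Rightarrow> real) \<Rightarrow> 'a \<Rightarrow> 'a \<Rightarrow> 'a" where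
  "hessian g x = frechet_derivative (gradient g) (at x)"

text \<open>The Hessian map is taken in \<open>'a \<Rightarrow>\<^sub>L 'a\<close>, so its continuity is continuity in the
  operator norm.\<close>

definition C2 :: "('a::euclidean_space \<Rightarrow> real) \<Rightarrow> bool" where
  "C2 g \<longleftrightarrow> (\<exists>(D :: 'a \<Rightarrow> 'a) (H :: 'a \<Rightarrow> 'a \<Rightarrow>\<^sub>L 'a).
      (\<forall>x. GDERIV g x :> D x) \<and>
      (\<forall>x. (D has_derivative blinfun_apply (H x)) (at x)) \<and>
      continuous_on UNIV H)"

text \<open>To be used for twice continuously differentiable \<open>g\<close>; symmetry of the Hessian is
  then automatic, so positive semidefiniteness is just nonnegativity of the quadratic form.\<close>

definition second_order_stationary :: "('a::euclidean_space \<Rightarrow> real) \<Rightarrow> 'a \<Rightarrow> bool" where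
  "second_order_stationary g x \<longleftrightarrow> gradient g x = 0 \<and> (\<forall>v. 0 \<le> v \<bullet> hessian g x v)"


section \<open>Subdifferentials\<close>

definition convex_subdifferential :: "('a::euclidean_space \<Rightarrow> real) \<Rightarrow> 'a \<Rightarrow> 'a set" where
  "convex_subdifferential g x = {v. \<forall>y. g x + v \<bullet> (y - x) \<le> g y}"

text \<open>Regular (Frechet) subgradients: \<open>g y \<ge> g x + \<langle>v, y - x\<rangle> + o(\<parallel>y - x\<parallel>)\<close>
  as \<open>y \<rightarrow> x\<close>, at points where \<open>g\<close> is finite.\<close>

definition regular_subdifferential :: "('a::euclidean_space \<Rightarrow> ereal) \<Rightarrow> 'a \<Rightarrow> 'a set" where
  "regular_subdifferential g x =
     {v. \<bar>g x\<bar> \<noteq> \<infinity> \<and>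
         (\<forall>\<epsilon>>0. \<forall>\<^sub>F y in nhds x. g x + ereal (v \<bullet> (y - x) - \<epsilon> * norm (y - x)) \<le> g y)}"

definition limiting_subdifferential :: "('a::euclidean_space \<Rightarrow> ereal) \<Rightarrow> 'a \<Rightarrow> 'a set" where
  "limiting_subdifferential g x =
     {v. \<bar>g x\<bar> \<noteq> \<infinity> \<and>
         (\<exists>X V. X \<longlonglongrightarrow> x \<and> (\<lambda>k. g (X k)) \<longlonglongrightarrow> g x \<and>
                (\<forall>k. V k \<in> regular_subdifferential g (X k)) \<and> V \<longlonglongrightarrow> v)}"


section \<open>The Kurdyka-Lojasiewicz property with exponent\<close>

text \<open>Distance of the origin to a set, with value \<open>\<infinity>\<close> on the empty set
  (unlike \<^const>\<open>infdist\<close>, which is 0 there).\<close>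

definition edist0 :: "'a::euclidean_space set \<Rightarrow> ereal" where
  "edist0 S = (INF v\<in>S. ereal (dist 0 v))"

text \<open>Intended for proper closed \<open>g\<close> that do not take the value \<open>-\<infinity>\<close>. Nonemptiness of the
  subdifferential makes \<open>g xbar\<close> finite, and \<open>g x - g xbar < r\<close> makes \<open>g x\<close> finite even for
  \<open>r = \<infinity>\<close>, so the \<^const>\<open>real_of_ereal\<close> below is applied to a finite positive number.\<close>

definition KL_property :: "('a::euclidean_space \<Rightarrow> ereal) \<Rightarrow> 'a \<Rightarrow> real \<Rightarrow> bool" where
  "KL_property g xbar \<alpha> \<longleftrightarrow>
     0 \<le> \<alpha> \<and> \<alpha> < 1 \<and> limiting_subdifferential g xbar \<noteq> {} \<and>
     (\<exists>(c::real) (r::ereal) V. 0 < c \<and> 0 < r \<and> open V \<and> xbar \<in> V \<and>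
        (\<forall>x\<in>V. 0 < g x - g xbar \<and> g x - g xbar < r \<longrightarrow>
           1 \<le> ereal (c * (1 - \<alpha>) * real_of_ereal (g x - g xbar) powr (- \<alpha>))
                * edist0 (limiting_subdifferential g x)))"


section \<open>Vector operations\<close>

definition l1norm :: "real ^ 'n \<Rightarrow> real" where
  "l1norm x = (\<Sum>i\<in>UNIV. \<bar>x $ i\<bar>)"

definition vec_square :: "real ^ 'n \<Rightarrow> real ^ 'n" where
  "vec_square a = (\<chi> i. (a $ i)\<^sup>2)"

end

theory Submission
  imports Defs
begin

text \<open>Write \<open>x = a\<^sup>2 - b\<^sup>2\<close> and let \<open>z\<close> be \<open>x\<close> with the coordinates outside the support of \<open>s\<close>
  set to 0. By the relative interior condition, for each \<open>i\<close> one of the two factors of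
  \<open>2a\<^sub>i (\<nabla>\<^sub>ih(x) + \<mu>)\<close> and of \<open>2b\<^sub>i (\<mu> - \<nabla>\<^sub>ih(x))\<close> stays away from 0 near the
  stationary point, so the other
  one is \<open>O(\<parallel>\<nabla>F\<parallel>)\<close>. Hence \<open>x - z\<close> and \<open>min (a\<^sub>i\<^sup>2) (b\<^sub>i\<^sup>2)\<close> are \<open>O(\<parallel>\<nabla>F\<parallel>\<^sup>2)\<close>, which gives
  \<open>F(a, b) \<le> f(z) + O(\<parallel>\<nabla>F\<parallel>\<^sup>2)\<close>, and \<open>\<partial>f(z)\<close> contains an element of norm \<open>O(\<parallel>\<nabla>F\<parallel>)\<close>.
  The KL inequality of \<open>f\<close> at \<open>z\<close> (not at \<open>x\<close>, where \<open>\<partial>f\<close> may stay away from 0) then bounds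
  \<open>f(z) - f(s)\<close> by \<open>O(\<parallel>\<nabla>F\<parallel>\<^bsup>1/\<alpha>\<^esup>)\<close>.\<close>

section \<open>Subdifferentials of smooth functions and of smooth plus convex functions\<close>

lemma GDERIV_first_order_bound:
  assumes "GDERIV g x :> D" "e > 0"
  shows "\<forall>\<^sub>F y in nhds x. \<bar>g y - g x - D \<bullet> (y - x)\<bar> \<le> e * norm (y - x)"
proof -
  have "(g has_derivative (\<lambda>v. v \<bullet> D)) (at x)"
    using assms(1) by (simp add: gderiv_def)
  then have "\<exists>d>0. \<forall>y. norm (y - x) < d \<longrightarrow> norm (g y - g x - (y - x) \<bullet> D) \<le> e * norm (y - x)"
    using assms(2) unfolding has_derivative_at_alt by blast
  then show ?thesis
    by (auto simp: eventually_nhds_metric dist_norm inner_commute)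
qed

text \<open>A regular subgradient \<open>v\<close> and the first-order expansion at \<open>x\<close>
  each allow an error \<open>e * norm (y - x)\<close>; testing along the direction
  \<open>v - D\<close> forces \<open>norm (v - D) \<le> 2 * e\<close> for every
  \<open>e > 0\<close>.\<close>

lemma regular_subdifferential_GDERIV:
  assumes "GDERIV g x :> D"
  shows "regular_subdifferential (\<lambda>x. ereal (g x)) x = {D}"
proof (intro equalityI subsetI)
  fix v assume v: "v \<in> regular_subdifferential (\<lambda>x. ereal (g x)) x"
  have bound: "norm (v - D) \<le> 2 * e" if "e > 0" for e
  proof (cases "v = D")
    case False
    have "\<forall>\<^sub>F y in nhds x. g x + (v \<bullet> (y - x) - e * norm (y - x)) \<le> g y"
      using v that by (simp add: regular_subdifferential_def)
    with GDERIV_first_order_bound[OF assms that]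
    have "\<forall>\<^sub>F y in nhds x. (v - D) \<bullet> (y - x) \<le> 2 * e * norm (y - x)"
      by eventually_elim (simp add: inner_diff_left)
    then obtain d where d: "d > 0"
      "\<And>y. dist y x < d \<Longrightarrow> (v - D) \<bullet> (y - x) \<le> 2 * e * norm (y - x)"
      by (auto simp: eventually_nhds_metric)
    \<comment> \<open>The test point \<open>x + t *\<^sub>R (v - D)\<close> lies at distance
      \<open>d / 2\<close> from \<open>x\<close>, so inside the ball where the inequality
      holds.\<close>
    define t where "t = d / (2 * norm (v - D))"
    have t: "t > 0" "t * norm (v - D) < d"
      using d(1) False by (auto simp: t_def)
    then have "t * (norm (v - D) * norm (v - D)) \<le> t * (2 * e * norm (v - D))"
      using d(2)[of "x + t *\<^sub>R (v - D)"] by (simp add: dist_norm dot_square_norm power2_eq_square mult_ac)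
    then show ?thesis
      using t(1) False by simp
  qed (use that in auto)
  have "norm (v - D) \<le> 0"
    by (rule field_le_epsilon) (use bound[of "e/2" for e] in force)
  then show "v \<in> {D}" by simp
next
  fix v assume "v \<in> {D}"
  moreover have "\<forall>\<^sub>F y in nhds x. g x + (D \<bullet> (y - x) - e * norm (y - x)) \<le> g y" if "e > 0" for e
    using GDERIV_first_order_bound[OF assms that] by eventually_elim simp
  ultimately show "v \<in> regular_subdifferential (\<lambda>x. ereal (g x)) x"
    by (simp add: regular_subdifferential_def)
qed

lemma regular_subset_limiting_subdifferential:
  "regular_subdifferential g x \<subseteq> limiting_subdifferential g x"
  unfolding limiting_subdifferential_def
  by (auto simp: regular_subdifferential_def[of g x]
      intro!: exI[of _ "\<lambda>_. x"] exI[of _ "\<lambda>_. v" for v])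

text \<open>Regular subgradients along a sequence are the values of \<open>D\<close> there, and
  continuity of \<open>D\<close> identifies their limit.\<close>

lemma limiting_subdifferential_C1:
  assumes "\<And>x. GDERIV g x :> D x" "continuous_on UNIV D"
  shows "limiting_subdifferential (\<lambda>x. ereal (g x)) x = {D x}"
proof
  show "{D x} \<subseteq> limiting_subdifferential (\<lambda>x. ereal (g x)) x"
    using regular_subset_limiting_subdifferential regular_subdifferential_GDERIV[OF assms(1)]
    by metis
  show "limiting_subdifferential (\<lambda>x. ereal (g x)) x \<subseteq> {D x}"
  proof
    fix v assume "v \<in> limiting_subdifferential (\<lambda>x. ereal (g x)) x"
    then obtain X V where X: "X \<longlonglongrightarrow> x" "V \<longlonglongrightarrow> v"
      and "\<And>k. V k \<in> regular_subdifferential (\<lambda>x. ereal (g x)) (X k)"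
      by (auto simp: limiting_subdifferential_def)
    then have "V = (\<lambda>k. D (X k))"
      by (auto simp: regular_subdifferential_GDERIV[OF assms(1)])
    moreover have "(\<lambda>k. D (X k)) \<longlonglongrightarrow> D x"
      using assms(2) X(1) by (intro isCont_tendsto_compose[of _ D]) (auto simp: continuous_on_eq_continuous_at)
    ultimately show "v \<in> {D x}"
      using X(2) LIMSEQ_unique by auto
  qed
qed

text \<open>The global inequality for \<open>\<phi>\<close> adds to the first-order expansion of
  \<open>g\<close>. This exhibits explicit elements of the subdifferential of \<open>f\<close>, each
  of which bounds \<open>edist0\<close> from above.\<close>

lemma GDERIV_add_convex_subgradient:
  assumes "GDERIV g x :> D" "u \<in> convex_subdifferential \<phi> x"
  shows "D + u \<in> limiting_subdifferential (\<lambda>x. ereal (g x + \<phi> x)) x"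
proof -
  have "\<forall>\<^sub>F y in nhds x. g x + \<phi> x + ((D + u) \<bullet> (y - x) - e * norm (y - x)) \<le> g y + \<phi> y" if "e > 0" for e
    using GDERIV_first_order_bound[OF assms(1) that]
  proof eventually_elim
    case (elim y)
    moreover have "\<phi> x + u \<bullet> (y - x) \<le> \<phi> y"
      using assms(2) by (auto simp: convex_subdifferential_def)
    ultimately show ?case by (simp add: inner_add_left)
  qed
  then have "D + u \<in> regular_subdifferential (\<lambda>x. ereal (g x + \<phi> x)) x"
    by (simp add: regular_subdifferential_def)
  then show ?thesis
    using regular_subset_limiting_subdifferential by blast
qed

section \<open>The subdifferential of the l1 norm and its relative interior\<close>

lemma convex_convex_subdifferential: "convex (convex_subdifferential g x)"
proof -
  have "convex_subdifferential g x = (\<Inter>y. {v. (y - x) \<bullet> v \<le> g y - g x})"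
    by (auto simp: convex_subdifferential_def inner_commute algebra_simps)
  then show ?thesis
    by (simp add: convex_INT convex_halfspace_le)
qed

text \<open>The norm is separable, so perturbing one coordinate gives the necessary conditions, and
  summing the one-dimensional inequalities gives sufficiency.\<close>

lemma convex_subdifferential_l1norm_iff:
  "v \<in> convex_subdifferential l1norm x \<longleftrightarrow> (\<forall>i. v $ i * x $ i = \<bar>x $ i\<bar> \<and> \<bar>v $ i\<bar> \<le> 1)"
proof
  assume v: "v \<in> convex_subdifferential l1norm x"
  show "\<forall>i. v $ i * x $ i = \<bar>x $ i\<bar> \<and> \<bar>v $ i\<bar> \<le> 1"
  proof
    fix i
    have *: "\<bar>x $ i\<bar> + v $ i * t \<le> \<bar>x $ i + t\<bar>" for t
    proof -
      have "l1norm x + v \<bullet> axis i t \<le> l1norm (x + axis i t)"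
        using v by (auto simp: convex_subdifferential_def dest: spec[of _ "x + axis i t"])
      moreover have "l1norm (x + axis i t) = l1norm x - \<bar>x $ i\<bar> + \<bar>x $ i + t\<bar>"
        by (simp add: l1norm_def sum.remove[of UNIV i] axis_def)
      ultimately show ?thesis by (simp add: inner_axis)
    qed
    show "v $ i * x $ i = \<bar>x $ i\<bar> \<and> \<bar>v $ i\<bar> \<le> 1"
      \<comment> \<open>The steps \<open>x $ i\<close> and \<open>- x $ i\<close> give the two
        halves of the equality, the steps 1 and -1 the bound on \<open>v $ i\<close>.\<close>
      using *[of "x $ i"] *[of "- x $ i"] *[of 1] *[of "-1"] by auto
  qed
next
  assume v: "\<forall>i. v $ i * x $ i = \<bar>x $ i\<bar> \<and> \<bar>v $ i\<bar> \<le> 1"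
  have "l1norm x + v \<bullet> (y - x) \<le> l1norm y" for y
  proof -
    have "\<bar>x $ i\<bar> + v $ i * (y $ i - x $ i) \<le> \<bar>y $ i\<bar>" for i
    proof -
      have "v $ i * y $ i \<le> \<bar>v $ i\<bar> * \<bar>y $ i\<bar>" by (metis abs_ge_self abs_mult)
      also have "\<dots> \<le> \<bar>y $ i\<bar>" using v by (simp add: mult_left_le_one_le)
      finally show ?thesis using v by (simp add: algebra_simps)
    qed
    then show ?thesis
      unfolding l1norm_def inner_vec_def sum.distrib[symmetric] by (intro sum_mono) auto
  qed
  then show "v \<in> convex_subdifferential l1norm x"
    by (simp add: convex_subdifferential_def)
qed

text \<open>On the support the subgradient is determined. Off the support, a relative interior point
  can be pushed slightly away from any other point of the set; if
  \<open>\<bar>w $ i\<bar> = \<mu>\<close>, pushing it away from a point with zero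
  \<open>i\<close>-th coordinate would leave the box.\<close>

lemma rel_interior_scaled_l1norm_subdifferential:
  assumes "\<mu> > 0" "w \<in> rel_interior ((\<lambda>v. \<mu> *\<^sub>R v) ` convex_subdifferential l1norm x)"
  shows "x $ i \<noteq> 0 \<Longrightarrow> w $ i = \<mu> * sgn (x $ i)" and "x $ i = 0 \<Longrightarrow> \<bar>w $ i\<bar> < \<mu>"
proof -
  let ?S = "(\<lambda>v. \<mu> *\<^sub>R v) ` convex_subdifferential l1norm x"
  have "w \<in> ?S" using assms(2) rel_interior_subset by blast
  then obtain v where v: "v \<in> convex_subdifferential l1norm x" "w = \<mu> *\<^sub>R v" by auto
  have v': "v $ j * x $ j = \<bar>x $ j\<bar>" "\<bar>v $ j\<bar> \<le> 1" for j
    using v(1) by (auto simp: convex_subdifferential_l1norm_iff)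
  show "w $ i = \<mu> * sgn (x $ i)" if "x $ i \<noteq> 0"
    using v'(1)[of i] v(2) that by (simp add: abs_sgn)
  show "\<bar>w $ i\<bar> < \<mu>" if "x $ i = 0"
  proof (rule ccontr)
    assume "\<not> \<bar>w $ i\<bar> < \<mu>"
    then have v1: "\<bar>v $ i\<bar> = 1"
      using v(2) v'(2)[of i] assms(1) by (auto simp: abs_mult)
    \<comment> \<open>Resetting coordinate \<open>i\<close> is admissible because
      \<open>x $ i = 0\<close>; extrapolation from \<open>u\<close> then multiplies
      \<open>w $ i\<close> by \<open>e > 1\<close>.\<close>
    define u where "u = (\<chi> j. if j = i then 0 else v $ j)"
    have "u \<in> convex_subdifferential l1norm x"
      using v' that by (auto simp: convex_subdifferential_l1norm_iff u_def)
    then have "\<mu> *\<^sub>R u \<in> ?S" by blast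
    moreover have "convex ?S"
      by (intro convex_scaling convex_convex_subdifferential)
    ultimately obtain e where e: "e > 1" "(1 - e) *\<^sub>R (\<mu> *\<^sub>R u) + e *\<^sub>R w \<in> ?S"
      using assms(2) convex_rel_interior_iff[of ?S w] by blast
    then obtain q where q: "q \<in> convex_subdifferential l1norm x"
        "(1 - e) *\<^sub>R (\<mu> *\<^sub>R u) + e *\<^sub>R w = \<mu> *\<^sub>R q" by blast
    have "((1 - e) *\<^sub>R (\<mu> *\<^sub>R u) + e *\<^sub>R w) $ i = e * (\<mu> * v $ i)"
      by (simp add: u_def v(2))
    then have "\<mu> * q $ i = \<mu> * (e * v $ i)"
      unfolding q(2) by simp
    then have "q $ i = e * v $ i" using assms(1) by simp
    then have "\<bar>q $ i\<bar> = e" using e(1) v1 by (simp add: abs_mult)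
    moreover have "\<bar>q $ i\<bar> \<le> 1" using q(1) by (auto simp: convex_subdifferential_l1norm_iff)
    ultimately show False using e(1) by simp
  qed
qed

section \<open>The gradient of \<open>F\<close> and local Lipschitz bounds for \<open>h\<close> and
  its gradient\<close>

lemma gradient_eq:
  assumes "GDERIV g x :> D" shows "gradient g x = D"
proof -
  have "D' = D" if "GDERIV g x :> D'" for D'
    using regular_subdifferential_GDERIV[OF assms] regular_subdifferential_GDERIV[OF that] by simp
  then show ?thesis
    unfolding gradient_def using assms by blast
qed

text \<open>The gradient of \<open>F\<close> when \<open>D\<close> is the gradient of
  \<open>h\<close>. The estimates below exploit that each entry is a product.\<close>

definition hadamard_gradient :: "(real ^ 'n \<Rightarrow> real ^ 'n) \<Rightarrow> real \<Rightarrow> (real ^ 'n) \<times> (real ^ 'n) \<Rightarrow> (real ^ 'n) \<times> (real ^ 'n)"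
  where "hadamard_gradient D \<mu> p = (let x = vec_square (fst p) - vec_square (snd p) in
     (\<chi> i. 2 * fst p $ i * (D x $ i + \<mu>), \<chi> i. 2 * snd p $ i * (\<mu> - D x $ i)))"

lemma continuous_on_vec_square_diff:
  "continuous_on UNIV (\<lambda>p. vec_square (fst p) - vec_square (snd p))"
  unfolding vec_square_def by (intro continuous_intros)

lemma continuous_on_hadamard_gradient:
  assumes "continuous_on UNIV D"
  shows "continuous_on UNIV (hadamard_gradient D \<mu>)"
  unfolding hadamard_gradient_def Let_def
  by (intro continuous_intros continuous_on_compose2[OF assms continuous_on_vec_square_diff]) auto

lemma GDERIV_hadamard:
  fixes D :: "real ^ 'n \<Rightarrow> real ^ 'n"
  assumes "\<And>x. GDERIV h x :> D x"
  shows "GDERIV (\<lambda>(a, b). h (vec_square a - vec_square b)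
                        + \<mu> * (\<Sum>i\<in>UNIV. (a $ i)\<^sup>2 + (b $ i)\<^sup>2)) p :> hadamard_gradient D \<mu> p"
proof -
  let ?S = "\<lambda>p::(real ^ 'n) \<times> (real ^ 'n). \<chi> i. (fst p $ i)\<^sup>2 - (snd p $ i)\<^sup>2"
  have S: "?S p = vec_square (fst p) - vec_square (snd p)" for p
    by (simp add: vec_square_def vec_eq_iff)
  have nth: "((\<lambda>p. fst p $ i) has_derivative (\<lambda>v. fst v $ i)) (at p)"
      "((\<lambda>p. snd p $ i) has_derivative (\<lambda>v. snd v $ i)) (at p)" for i
    by (intro bounded_linear.has_derivative[OF bounded_linear_vec_nth]
        has_derivative_fst has_derivative_snd has_derivative_ident)+
  have "(?S has_derivative (\<lambda>v. \<chi> i. 2 * fst p $ i * fst v $ i - 2 * snd p $ i * snd v $ i)) (at p)"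
    unfolding has_derivative_componentwise_within[of ?S]
    by (auto simp: Basis_vec_def inner_axis power2_eq_square algebra_simps
        intro!: derivative_eq_intros nth)
  moreover have "(h has_derivative (\<lambda>v. v \<bullet> D (?S p))) (at (?S p))"
    using assms by (simp add: gderiv_def)
  ultimately have "((\<lambda>p. h (?S p)) has_derivative
     (\<lambda>v. (\<chi> i. 2 * fst p $ i * fst v $ i - 2 * snd p $ i * snd v $ i) \<bullet> D (?S p))) (at p)"
    by (rule has_derivative_compose)
  moreover have "((\<lambda>p. \<mu> * (\<Sum>i\<in>UNIV. (fst p $ i)\<^sup>2 + (snd p $ i)\<^sup>2)) has_derivative
     (\<lambda>v. \<mu> * (\<Sum>i\<in>UNIV. 2 * fst p $ i * fst v $ i + 2 * snd p $ i * snd v $ i))) (at p)"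
    by (auto intro!: derivative_eq_intros nth simp: power2_eq_square algebra_simps)
  ultimately have "((\<lambda>p. h (?S p) + \<mu> * (\<Sum>i\<in>UNIV. (fst p $ i)\<^sup>2 + (snd p $ i)\<^sup>2)) has_derivative
     (\<lambda>v. (\<chi> i. 2 * fst p $ i * fst v $ i - 2 * snd p $ i * snd v $ i) \<bullet> D (?S p)
      + \<mu> * (\<Sum>i\<in>UNIV. 2 * fst p $ i * fst v $ i + 2 * snd p $ i * snd v $ i))) (at p)"
    by (rule has_derivative_add)
  moreover have "(\<lambda>v. (\<chi> i. 2 * fst p $ i * fst v $ i - 2 * snd p $ i * snd v $ i) \<bullet> D (?S p)
      + \<mu> * (\<Sum>i\<in>UNIV. 2 * fst p $ i * fst v $ i + 2 * snd p $ i * snd v $ i)) = (\<lambda>v. v \<bullet> hadamard_gradient D \<mu> p)"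
    by (simp add: hadamard_gradient_def Let_def S inner_prod_def inner_vec_def sum_distrib_left sum.distrib[symmetric] algebra_simps)
  ultimately show ?thesis
    by (simp add: gderiv_def S case_prod_unfold)
qed

text \<open>By compactness the Hessian and the gradient are bounded on the closed unit ball around
  \<open>x\<close>; the mean value inequality on this convex set turns the bounds into Lipschitz
  constants.\<close>

lemma C2_locally_lipschitz:
  fixes g :: "'a::euclidean_space \<Rightarrow> real"
  assumes "C2 g"
  obtains D L M where "\<And>x. GDERIV g x :> D x" "continuous_on UNIV D" "L \<ge> 0" "M \<ge> 0"
    "\<And>u v. u \<in> cball x 1 \<Longrightarrow> v \<in> cball x 1 \<Longrightarrow> norm (D u - D v) \<le> L * norm (u - v)"
    "\<And>u v. u \<in> cball x 1 \<Longrightarrow> v \<in> cball x 1 \<Longrightarrow> \<bar>g u - g v\<bar> \<le> M * norm (u - v)"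
proof -
  obtain D :: "'a \<Rightarrow> 'a" and H :: "'a \<Rightarrow> 'a \<Rightarrow>\<^sub>L 'a" where D: "\<And>x. GDERIV g x :> D x"
    and H: "\<And>x. (D has_derivative blinfun_apply (H x)) (at x)" and contH: "continuous_on UNIV H"
    using assms by (auto simp: C2_def)
  have contD: "continuous_on UNIV D"
    using H by (meson has_derivative_continuous continuous_at_imp_continuous_on)
  have bdd: "\<exists>B\<ge>0. \<forall>y\<in>cball x 1. norm (f y) \<le> B" if "continuous_on UNIV f" for f :: "'a \<Rightarrow> 'c::real_normed_vector"
  proof -
    have "bounded (f ` cball x 1)"
      by (intro compact_imp_bounded compact_continuous_image continuous_on_subset[OF that]) auto
    then show ?thesis by (auto simp: bounded_pos intro: less_imp_le)
  qed
  obtain L where L: "L \<ge> 0" "\<And>y. y \<in> cball x 1 \<Longrightarrow> norm (H y) \<le> L"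
    using bdd[OF contH] by auto
  obtain M where M: "M \<ge> 0" "\<And>y. y \<in> cball x 1 \<Longrightarrow> norm (D y) \<le> M"
    using bdd[OF contD] by auto
  show ?thesis
  proof (rule that[OF D contD L(1) M(1)])
    fix u v assume uv: "u \<in> cball x 1" "v \<in> cball x 1"
    show "norm (D u - D v) \<le> L * norm (u - v)"
      using uv by (intro differentiable_bound[OF convex_cball, of x 1 D "\<lambda>y. blinfun_apply (H y)"])
        (auto intro: has_derivative_at_withinI[OF H] L(2) simp: norm_blinfun.rep_eq[symmetric])
    have "onorm (\<lambda>v. v \<bullet> D y) \<le> M" if "y \<in> cball x 1" for y
    proof (rule onorm_le)
      fix v
      have "\<bar>v \<bullet> D y\<bar> \<le> norm v * norm (D y)" by (rule Cauchy_Schwarz_ineq2)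
      also have "\<dots> \<le> M * norm v"
        using mult_left_mono[OF M(2)[OF that] norm_ge_zero] by (simp add: mult.commute)
      finally show "norm (v \<bullet> D y) \<le> M * norm v" by simp
    qed
    then have "norm (g u - g v) \<le> M * norm (u - v)"
      using uv D by (intro differentiable_bound[OF convex_cball, of x 1 g "\<lambda>y v. v \<bullet> D y"])
        (auto simp: gderiv_def intro: has_derivative_at_withinI)
    then show "\<bar>g u - g v\<bar> \<le> M * norm (u - v)" by simp
  qed
qed


section \<open>The KL property as an inequality between real numbers\<close>

text \<open>The norm of any single subgradient dominates \<open>edist0\<close>, so the KL inequality
  can be used with whichever element is at hand.\<close>

lemma KL_property_real_inequality:
  assumes "KL_property (\<lambda>x. ereal (f x)) x \<alpha>"
  obtains C r where "C > 0" "r > 0"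
    "\<forall>\<^sub>F y in nhds x. \<forall>w\<in>limiting_subdifferential (\<lambda>x. ereal (f x)) y.
       0 < f y - f x \<longrightarrow> f y - f x < r \<longrightarrow> (f y - f x) powr \<alpha> \<le> C * norm w"
proof -
  obtain c :: real and r :: ereal and V where c: "c > 0" "r > 0" "open V" "x \<in> V" "\<alpha> < 1"
    and V: "\<And>y. y \<in> V \<Longrightarrow> 0 < f y - f x \<Longrightarrow> ereal (f y - f x) < r \<Longrightarrow>
        1 \<le> ereal (c * (1 - \<alpha>) * (f y - f x) powr (- \<alpha>))
            * edist0 (limiting_subdifferential (\<lambda>x. ereal (f x)) y)"
    using assms by (auto simp: KL_property_def)
  \<comment> \<open>The bound \<open>r\<close> may be infinite; a smaller finite one only restricts
    the points considered.\<close>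
  obtain r' :: real where r': "r' > 0" "ereal r' < r"
    using ereal_dense2[OF c(2)] by (auto simp: zero_ereal_def)
  have "(f y - f x) powr \<alpha> \<le> c * (1 - \<alpha>) * norm w"
    if "y \<in> V" and w: "w \<in> limiting_subdifferential (\<lambda>x. ereal (f x)) y"
      and d: "0 < f y - f x" "f y - f x < r'" for y w
  proof -
    let ?d = "f y - f x"
    have "ereal ?d < r" using d(2) r'(2) by (meson less_ereal.simps(1) less_trans)
    with V[OF that(1) d(1)]
    have "1 \<le> ereal (c * (1 - \<alpha>) * ?d powr (- \<alpha>))
            * edist0 (limiting_subdifferential (\<lambda>x. ereal (f x)) y)" by simp
    also have "\<dots> \<le> ereal (c * (1 - \<alpha>) * ?d powr (- \<alpha>)) * ereal (norm w)"
      using c(1,5) w by (intro ereal_mult_left_mono) (auto simp: edist0_def intro: INF_lower2)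
    finally have "1 \<le> c * (1 - \<alpha>) * ?d powr (- \<alpha>) * norm w"
      by (simp add: one_ereal_def)
    then show ?thesis
      using d(1) by (simp add: powr_minus field_simps)
  qed
  then have "\<forall>\<^sub>F y in nhds x. \<forall>w\<in>limiting_subdifferential (\<lambda>x. ereal (f x)) y.
       0 < f y - f x \<longrightarrow> f y - f x < r' \<longrightarrow> (f y - f x) powr \<alpha> \<le> c * (1 - \<alpha>) * norm w"
    using c(3,4) by (auto simp: eventually_nhds intro!: exI[of _ V])
  then show ?thesis
    using c(1,5) r'(1) by (intro that[of "c * (1 - \<alpha>)" r']) auto
qed

text \<open>The subdifferential of a \<open>C\<^sup>1\<close> function is a singleton, so
  \<open>edist0\<close> is the gradient norm. The constant \<open>K / (1 - \<alpha>)\<close> cancels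
  the factor \<open>1 - \<alpha>\<close> in the definition.\<close>

lemma KL_property_C1I:
  assumes "\<And>x. GDERIV g x :> D x" "continuous_on UNIV D"
    and "0 \<le> \<alpha>" "\<alpha> < 1" "K > 0" "r > 0"
    and "\<forall>\<^sub>F y in nhds x. 0 < g y - g x \<longrightarrow> g y - g x < r \<longrightarrow> (g y - g x) powr \<alpha> \<le> K * norm (D y)"
  shows "KL_property (\<lambda>x. ereal (g x)) x \<alpha>"
proof -
  obtain V where V: "open V" "x \<in> V"
    "\<And>y. y \<in> V \<Longrightarrow> 0 < g y - g x \<Longrightarrow> g y - g x < r \<Longrightarrow> (g y - g x) powr \<alpha> \<le> K * norm (D y)"
    using assms(7) by (auto simp: eventually_nhds)
  have "1 \<le> ereal (K / (1 - \<alpha>) * (1 - \<alpha>) * (g y - g x) powr (- \<alpha>)) * edist0 {D y}"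
    if "y \<in> V" "0 < g y - g x" "g y - g x < r" for y
  proof -
    have "1 \<le> K * (g y - g x) powr (- \<alpha>) * norm (D y)"
      using V(3)[OF that] that(2) by (simp add: powr_minus field_simps)
    then show ?thesis
      using assms(4) by (simp add: edist0_def one_ereal_def)
  qed
  then show ?thesis
    unfolding KL_property_def limiting_subdifferential_C1[OF assms(1,2)]
    using V(1,2) assms(3-6)
    by (intro conjI exI[of _ "K / (1 - \<alpha>)"] exI[of _ "ereal r"] exI[of _ V]) auto
qed

section \<open>Auxiliary bounds and quantitative estimates near the stationary point\<close>

text \<open>Stating the bound for all small \<open>k > 0\<close> as a filter lets finitely many such
  bounds share one \<open>k\<close>.\<close>

lemma eventually_uniform_lower_bound:
  fixes \<phi> :: "'a::t2_space \<Rightarrow> real"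
  assumes "isCont \<phi> x" "\<phi> x \<noteq> 0"
  shows "\<forall>\<^sub>F k in at_right 0. \<forall>\<^sub>F y in nhds x. k \<le> \<bar>\<phi> y\<bar>"
proof -
  have "\<forall>\<^sub>F k in at_right 0. k < \<bar>\<phi> x\<bar>"
    using assms(2) by (intro order_tendstoD(2)[of "\<lambda>k. k" 0]) auto
  then show ?thesis
  proof eventually_elim
    case (elim k)
    have "((\<lambda>y. \<bar>\<phi> y\<bar>) \<longlongrightarrow> \<bar>\<phi> x\<bar>) (nhds x)"
      using assms(1) by (intro tendsto_rabs) (simp add: continuous_at tendsto_at_iff_tendsto_nhds)
    from order_tendstoD(1)[OF this elim] show ?case
      by eventually_elim simp
  qed
qed

text \<open>At least one of \<open>K * n\<^sup>2\<close> and \<open>d\<close> is at least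
  \<open>t / 2\<close>: the first gives exponent 1/2, the second exponent \<open>\<alpha>\<close>.
  As \<open>t < 1\<close>, raising the exponent to the maximum only lowers the power. In the
  application \<open>n\<close> is the gradient norm of \<open>F\<close> and \<open>d\<close> is
  \<open>f z - f s\<close>, possibly nonpositive.\<close>

lemma powr_max_half_bound:
  assumes "0 < t" "t < 1" "t \<le> K * n\<^sup>2 + d" "0 \<le> K" "0 \<le> n" "0 \<le> C"
    and "0 < \<alpha>" "\<alpha> < 1" and "0 < d \<Longrightarrow> d powr \<alpha> \<le> C * n"
  shows "t powr max \<alpha> (1/2) \<le> (sqrt (2 * K) + 2 * C) * n"
proof (cases "t \<le> 2 * (K * n\<^sup>2)")
  case True
  have "t powr max \<alpha> (1/2) \<le> t powr (1/2)"
    using assms(1,2) by (intro powr_mono') auto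
  also have "\<dots> = sqrt t" using assms(1) by (simp add: powr_half_sqrt)
  also have "\<dots> \<le> sqrt (2 * K * n\<^sup>2)" using True by simp
  also have "\<dots> = sqrt (2 * K) * n" using assms(5) by (simp add: real_sqrt_mult)
  also have "\<dots> \<le> (sqrt (2 * K) + 2 * C) * n"
    using assms(5,6) by (intro mult_right_mono) auto
  finally show ?thesis .
next
  case False
  then have d: "t \<le> 2 * d" "d > 0" using assms(1,3) by auto
  have "t powr max \<alpha> (1/2) \<le> t powr \<alpha>"
    using assms(1,2) by (intro powr_mono') auto
  also have "\<dots> \<le> (2 * d) powr \<alpha>"
    using assms(1,7) d by (intro powr_mono2) auto
  also have "\<dots> = 2 powr \<alpha> * d powr \<alpha>" using d by (simp add: powr_mult)
  also have "\<dots> \<le> 2 powr 1 * (C * n)"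
    using assms(8) assms(9)[OF d(2)] by (intro mult_mono powr_mono) auto
  also have "\<dots> \<le> (sqrt (2 * K) + 2 * C) * n"
    using assms(4,5) by (simp add: algebra_simps)
  finally show ?thesis .
qed

definition active_proj :: "real ^ 'n \<Rightarrow> real ^ 'n \<Rightarrow> real ^ 'n" where
  "active_proj s x = (\<chi> i. if s $ i = 0 then 0 else x $ i)"

text \<open>The assumptions name the large factor of each gradient entry, so the other one is at
  most \<open>n / \<kappa>\<close>: \<open>D x $ i + \<mu>\<close> and \<open>b $ i\<close> if
  \<open>s $ i > 0\<close>, \<open>a $ i\<close> and \<open>\<mu> - D x $ i\<close> if
  \<open>s $ i < 0\<close>, and both \<open>a $ i\<close> and \<open>b $ i\<close> if
  \<open>s $ i = 0\<close>.\<close>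

lemma hadamard_estimates:
  fixes D :: "real ^ 'n \<Rightarrow> real ^ 'n" and h :: "real ^ 'n \<Rightarrow> real"
    and a b s :: "real ^ 'n" and \<mu> \<kappa> L M :: real
  defines "x \<equiv> vec_square a - vec_square b"
  defines "z \<equiv> active_proj s x"
  defines "n \<equiv> norm (hadamard_gradient D \<mu> (a, b))"
  defines "w \<equiv> (\<chi> i. if s $ i = 0 then 0 else D z $ i + \<mu> * sgn (s $ i))"
  assumes "\<kappa> > 0" "\<mu> > 0" "L \<ge> 0" "M \<ge> 0"
    and \<kappa>a: "\<And>i. \<kappa> \<le> 2 * \<bar>if s $ i > 0 then a $ i else D x $ i + \<mu>\<bar>"
    and \<kappa>b: "\<And>i. \<kappa> \<le> 2 * \<bar>if s $ i < 0 then b $ i else \<mu> - D x $ i\<bar>"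
    and L: "norm (D x - D z) \<le> L * norm (x - z)"
    and M: "\<bar>h x - h z\<bar> \<le> M * norm (x - z)"
    and "n \<le> 1"
  shows "h x + \<mu> * (\<Sum>i\<in>UNIV. (a $ i)\<^sup>2 + (b $ i)\<^sup>2)
           \<le> h z + \<mu> * l1norm z + (M + 2 * \<mu>) * CARD('n) / \<kappa>\<^sup>2 * n\<^sup>2"
    and "norm w \<le> CARD('n) * (1 + L * CARD('n) / \<kappa>) / \<kappa> * n"
proof -
  define q where "q = n / \<kappa>"
  have q: "q \<ge> 0" using \<open>\<kappa> > 0\<close> by (simp add: q_def n_def)
  have divide: "\<bar>v\<bar> \<le> q" if "\<kappa> \<le> 2 * \<bar>u\<bar>" "\<bar>2 * u * v\<bar> \<le> n" for u v
  proof -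
    have "\<kappa> * \<bar>v\<bar> \<le> 2 * \<bar>u\<bar> * \<bar>v\<bar>" using that(1) by (rule mult_right_mono) simp
    also have "\<dots> \<le> n" using that(2) by (simp add: abs_mult)
    finally show ?thesis using \<open>\<kappa> > 0\<close> by (simp add: q_def field_simps)
  qed
  have "\<bar>fst (hadamard_gradient D \<mu> (a, b)) $ i\<bar> \<le> n" "\<bar>snd (hadamard_gradient D \<mu> (a, b)) $ i\<bar> \<le> n" for i
    unfolding n_def
    using order_trans[OF component_le_norm_cart norm_fst_le[of "fst (hadamard_gradient D \<mu> (a, b))"]]
      order_trans[OF component_le_norm_cart norm_snd_le[of "snd (hadamard_gradient D \<mu> (a, b))"]]
    by (metis prod.collapse)+
  then have grad: "\<bar>2 * a $ i * (D x $ i + \<mu>)\<bar> \<le> n" "\<bar>2 * b $ i * (\<mu> - D x $ i)\<bar> \<le> n" for i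
    by (auto simp: hadamard_gradient_def Let_def x_def)
  have qa: "\<bar>if s $ i > 0 then D x $ i + \<mu> else a $ i\<bar> \<le> q" for i
    using divide[OF \<kappa>a[of i]] grad(1)[of i] by (auto simp: mult_ac split: if_splits)
  have qb: "\<bar>if s $ i < 0 then \<mu> - D x $ i else b $ i\<bar> \<le> q" for i
    using divide[OF \<kappa>b[of i]] grad(2)[of i] by (auto simp: mult_ac split: if_splits)
  have sq: "u\<^sup>2 \<le> q\<^sup>2" if "\<bar>u\<bar> \<le> q" for u :: real
    using power_mono[OF that abs_ge_zero, of 2] by simp
  \<comment> \<open>Only coordinates with \<open>s $ i = 0\<close> differ, and there
    \<open>a $ i\<close> and \<open>b $ i\<close> are both of size \<open>q\<close>; their squares
    make the difference quadratic.\<close>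
  have xz: "\<bar>(x - z) $ i\<bar> \<le> q\<^sup>2" for i
  proof (cases "s $ i = 0")
    case True
    then have "(a $ i)\<^sup>2 \<le> q\<^sup>2" "(b $ i)\<^sup>2 \<le> q\<^sup>2"
      using sq[OF qa[of i]] sq[OF qb[of i]] by auto
    then have "\<bar>(a $ i)\<^sup>2 - (b $ i)\<^sup>2\<bar> \<le> q\<^sup>2"
      using zero_le_power2[of "a $ i"] zero_le_power2[of "b $ i"] by linarith
    then show ?thesis
      using True by (simp add: x_def z_def active_proj_def vec_square_def)
  qed (simp add: z_def active_proj_def)
  have "norm (x - z) \<le> (\<Sum>i\<in>UNIV. \<bar>(x - z) $ i\<bar>)" by (rule norm_le_l1_cart)
  also have "\<dots> \<le> of_nat CARD('n) * q\<^sup>2" using xz by (intro sum_bounded_above) auto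
  finally have xz_norm: "norm (x - z) \<le> CARD('n) * q\<^sup>2" by simp
  \<comment> \<open>On the support the excess of the sum of squares over
    \<open>\<bar>z $ i\<bar>\<close> is twice the smaller square; off the support both squares are
    small.\<close>
  have "(a $ i)\<^sup>2 + (b $ i)\<^sup>2 \<le> \<bar>z $ i\<bar> + 2 * q\<^sup>2" for i
  proof -
    have z: "z $ i = (if s $ i = 0 then 0 else (a $ i)\<^sup>2 - (b $ i)\<^sup>2)"
      by (simp add: z_def active_proj_def x_def vec_square_def)
    show ?thesis
      using sq[OF qa[of i]] sq[OF qb[of i]] unfolding z
      by (cases "s $ i" "0::real" rule: linorder_cases) simp_all
  qed
  then have "(\<Sum>i\<in>UNIV. (a $ i)\<^sup>2 + (b $ i)\<^sup>2) \<le> (\<Sum>i\<in>UNIV. \<bar>z $ i\<bar> + 2 * q\<^sup>2)"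
    by (intro sum_mono) auto
  then have "\<mu> * (\<Sum>i\<in>UNIV. (a $ i)\<^sup>2 + (b $ i)\<^sup>2) \<le> \<mu> * (l1norm z + CARD('n) * (2 * q\<^sup>2))"
    using \<open>\<mu> > 0\<close> by (simp add: l1norm_def sum.distrib)
  moreover have "h x \<le> h z + M * (CARD('n) * q\<^sup>2)"
    using M mult_left_mono[OF xz_norm \<open>M \<ge> 0\<close>] by linarith
  ultimately show "h x + \<mu> * (\<Sum>i\<in>UNIV. (a $ i)\<^sup>2 + (b $ i)\<^sup>2)
           \<le> h z + \<mu> * l1norm z + (M + 2 * \<mu>) * CARD('n) / \<kappa>\<^sup>2 * n\<^sup>2"
    by (simp add: q_def power_divide algebra_simps add_divide_distrib)
  \<comment> \<open>Here \<open>n \<le> 1\<close> weakens the quadratic bound on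
    \<open>x - z\<close> to a linear one, since \<open>norm w\<close> is to be bounded linearly in
    \<open>n\<close>.\<close>
  have "q \<le> 1 / \<kappa>" using \<open>n \<le> 1\<close> \<open>\<kappa> > 0\<close> by (simp add: q_def divide_right_mono)
  then have "q\<^sup>2 \<le> q / \<kappa>"
    using mult_left_mono[of q "1 / \<kappa>" q] q by (simp add: power2_eq_square)
  then have "L * norm (x - z) \<le> L * (CARD('n) * (q / \<kappa>))"
    using xz_norm \<open>L \<ge> 0\<close> by (meson mult_left_mono of_nat_0_le_iff order_trans)
  then have Dxz: "norm (D x - D z) \<le> L * (CARD('n) * (q / \<kappa>))" using L by linarith
  \<comment> \<open>On the support, replacing \<open>D z\<close> by \<open>D x\<close> in
    \<open>w $ i\<close> gives, up to sign, a small factor of the gradient entry.\<close>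
  have "\<bar>w $ i\<bar> \<le> q + L * (CARD('n) * (q / \<kappa>))" for i
  proof -
    have "\<bar>D x $ i - D z $ i\<bar> \<le> L * (CARD('n) * (q / \<kappa>))"
      using component_le_norm_cart[of "D x - D z" i] Dxz by simp
    then show ?thesis
      using qa[of i] qb[of i] q by (cases "s $ i" "0::real" rule: linorder_cases) (auto simp: w_def)
  qed
  then have "(\<Sum>i\<in>UNIV. \<bar>w $ i\<bar>) \<le> of_nat CARD('n) * (q + L * (CARD('n) * (q / \<kappa>)))"
    by (intro sum_bounded_above) auto
  with norm_le_l1_cart[of w]
  show "norm w \<le> CARD('n) * (1 + L * CARD('n) / \<kappa>) / \<kappa> * n"
    by (simp add: q_def algebra_simps add_divide_distrib)
qed


text \<open>At \<open>(a, b)\<close> none of these factors vanishes: \<open>s $ i > 0\<close> forces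
  \<open>a $ i \<noteq> 0\<close>, \<open>s $ i < 0\<close> forces \<open>b $ i \<noteq> 0\<close>,
  and the remaining factors equal \<open>2 * \<mu>\<close> on the support and are positive off it by
  strictness. Continuity and finiteness of the index set give a common
  \<open>\<kappa>\<close>.\<close>

lemma hadamard_factors_bounded_below:
  fixes D :: "real ^ 'n \<Rightarrow> real ^ 'n" and a b s :: "real ^ 'n"
  assumes contD: "continuous_on UNIV D" and "\<mu> > 0"
    and s: "s = vec_square a - vec_square b"
    and active: "\<And>i. s $ i \<noteq> 0 \<Longrightarrow> D s $ i = - \<mu> * sgn (s $ i)"
    and inactive: "\<And>i. s $ i = 0 \<Longrightarrow> \<bar>D s $ i\<bar> < \<mu>"
  obtains \<kappa> where "\<kappa> > 0"
    "\<forall>\<^sub>F p in nhds (a, b). \<forall>i.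
       \<kappa> \<le> 2 * \<bar>if s $ i > 0 then fst p $ i
                else D (vec_square (fst p) - vec_square (snd p)) $ i + \<mu>\<bar> \<and>
       \<kappa> \<le> 2 * \<bar>if s $ i < 0 then snd p $ i
                else \<mu> - D (vec_square (fst p) - vec_square (snd p)) $ i\<bar>"
proof -
  let ?x = "\<lambda>p. vec_square (fst p) - vec_square (snd p) :: real ^ 'n"
  let ?u = "\<lambda>i p. 2 * (if s $ i > 0 then fst p $ i else D (?x p) $ i + \<mu>)"
  let ?v = "\<lambda>i p. 2 * (if s $ i < 0 then snd p $ i else \<mu> - D (?x p) $ i)"
  have x: "?x (a, b) = s" by (simp add: s)
  have contDx: "continuous_on UNIV (\<lambda>p. D (?x p))"
    by (intro continuous_on_compose2[OF contD continuous_on_vec_square_diff]) auto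
  have cont: "continuous_on UNIV (?u i)" "continuous_on UNIV (?v i)" for i
    by (cases "s $ i > 0"; cases "s $ i < 0"; simp; intro continuous_intros contDx)+
  have nz: "?u i (a, b) \<noteq> 0 \<and> ?v i (a, b) \<noteq> 0" for i
    using active[of i] inactive[of i] \<open>\<mu> > 0\<close> s unfolding x
    by (cases "s $ i" "0::real" rule: linorder_cases) (auto simp: vec_square_def)
  have "\<forall>\<^sub>F k in at_right 0. \<forall>\<^sub>F p in nhds (a, b). k \<le> \<bar>?u i p\<bar> \<and> k \<le> \<bar>?v i p\<bar>" for i
  proof -
    have "\<forall>\<^sub>F k in at_right 0. \<forall>\<^sub>F p in nhds (a, b). k \<le> \<bar>?u i p\<bar>"
         "\<forall>\<^sub>F k in at_right 0. \<forall>\<^sub>F p in nhds (a, b). k \<le> \<bar>?v i p\<bar>"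
      using cont[of i] nz[of i]
      by (intro eventually_uniform_lower_bound; simp add: continuous_on_eq_continuous_at)+
    then show ?thesis
      by eventually_elim (rule eventually_conj)
  qed
  then have "\<forall>\<^sub>F k in at_right 0. \<forall>i. \<forall>\<^sub>F p in nhds (a, b). k \<le> \<bar>?u i p\<bar> \<and> k \<le> \<bar>?v i p\<bar>"
    by (intro eventually_all_finite) blast
  moreover have "\<forall>\<^sub>F k in at_right 0. (0::real) < k"
    by (simp add: eventually_at_right_less)
  ultimately have "\<forall>\<^sub>F k in at_right 0. 0 < k \<and> (\<forall>i. \<forall>\<^sub>F p in nhds (a, b). k \<le> \<bar>?u i p\<bar> \<and> k \<le> \<bar>?v i p\<bar>)"
    by eventually_elim blast
  then obtain k where k: "k > 0" "\<forall>i. \<forall>\<^sub>F p in nhds (a, b). k \<le> \<bar>?u i p\<bar> \<and> k \<le> \<bar>?v i p\<bar>"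
    using eventually_happens'[OF trivial_limit_at_right_real] by blast
  from k(2) have "\<forall>\<^sub>F p in nhds (a, b). \<forall>i. k \<le> \<bar>?u i p\<bar> \<and> k \<le> \<bar>?v i p\<bar>"
    by (intro eventually_all_finite) blast
  with k(1) show ?thesis
    by (intro that[of k]) (simp_all only: abs_mult abs_numeral)
qed

section \<open>Transfer of the KL inequality from \<open>f\<close> to \<open>F\<close>\<close>

theorem theorem3p8:
  fixes h f :: "real ^ 'n \<Rightarrow> real"
    and F :: "(real ^ 'n) \<times> (real ^ 'n) \<Rightarrow> real"
    and \<mu> \<alpha> :: real
    and a b s :: "real ^ 'n"
  assumes "C2 h" and "\<mu> > 0"
    and "f = (\<lambda>x. h x + \<mu> * l1norm x)"
    and "F = (\<lambda>(a, b). h (vec_square a - vec_square b)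
                        + \<mu> * (\<Sum>i\<in>UNIV. (a $ i)\<^sup>2 + (b $ i)\<^sup>2))"
    and "second_order_stationary F (a, b)"
    and "s = vec_square a - vec_square b"
    and "0 < \<alpha>" and "\<alpha> < 1"
    and "KL_property (\<lambda>x. ereal (f x)) s \<alpha>"
    and "- gradient h s \<in> rel_interior ((\<lambda>v. \<mu> *\<^sub>R v) ` convex_subdifferential l1norm s)"
  shows "KL_property (\<lambda>p. ereal (F p)) (a, b) (max \<alpha> (1/2))"
proof -
  let ?x = "\<lambda>p. vec_square (fst p) - vec_square (snd p) :: real ^ 'n"
  let ?z = "\<lambda>p. active_proj s (?x p)"
  let ?N = "real CARD('n)"
  obtain D L M where D: "\<And>x. GDERIV h x :> D x" and contD: "continuous_on UNIV D"
    and LM: "L \<ge> 0" "M \<ge> 0"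
      "\<And>u v. u \<in> cball s 1 \<Longrightarrow> v \<in> cball s 1 \<Longrightarrow> norm (D u - D v) \<le> L * norm (u - v)"
      "\<And>u v. u \<in> cball s 1 \<Longrightarrow> v \<in> cball s 1 \<Longrightarrow> \<bar>h u - h v\<bar> \<le> M * norm (u - v)"
    using C2_locally_lipschitz[OF \<open>C2 h\<close>] by metis
  have ri: "- D s \<in> rel_interior ((\<lambda>v. \<mu> *\<^sub>R v) ` convex_subdifferential l1norm s)"
    using assms(10) gradient_eq[OF D] by simp
  have active: "D s $ i = - \<mu> * sgn (s $ i)" if "s $ i \<noteq> 0" for i
    using rel_interior_scaled_l1norm_subdifferential(1)[OF \<open>\<mu> > 0\<close> ri that] by simp
  have inactive: "\<bar>D s $ i\<bar> < \<mu>" if "s $ i = 0" for i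
    using rel_interior_scaled_l1norm_subdifferential(2)[OF \<open>\<mu> > 0\<close> ri that] by simp
  obtain \<kappa> where "\<kappa> > 0" and \<kappa>: "\<forall>\<^sub>F p in nhds (a, b). \<forall>i.
       \<kappa> \<le> 2 * \<bar>if s $ i > 0 then fst p $ i else D (?x p) $ i + \<mu>\<bar> \<and>
       \<kappa> \<le> 2 * \<bar>if s $ i < 0 then snd p $ i else \<mu> - D (?x p) $ i\<bar>"
    using hadamard_factors_bounded_below[OF contD \<open>\<mu> > 0\<close> assms(6) active inactive] by blast
  obtain C r where "C > 0" "r > 0" and KL:
    "\<forall>\<^sub>F y in nhds s. \<forall>w\<in>limiting_subdifferential (\<lambda>x. ereal (f x)) y.
       0 < f y - f s \<longrightarrow> f y - f s < r \<longrightarrow> (f y - f s) powr \<alpha> \<le> C * norm w"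
    using KL_property_real_inequality[OF assms(9)] by blast
  have GF: "GDERIV F p :> hadamard_gradient D \<mu> p" for p
    unfolding assms(4) using GDERIV_hadamard[OF D] .
  have contG: "continuous_on UNIV (hadamard_gradient D \<mu>)"
    using continuous_on_hadamard_gradient[OF contD] .
  \<comment> \<open>Stationarity keeps the gradient norm below 1 nearby, as
    \<open>hadamard_estimates\<close> requires.\<close>
  have F0: "hadamard_gradient D \<mu> (a, b) = 0"
    using assms(5) gradient_eq[OF GF] by (simp add: second_order_stationary_def)
  have filterlim_at: "filterlim \<phi> (nhds (\<phi> p)) (nhds p)" if "continuous_on UNIV \<phi>"
    for \<phi> :: "'c::t2_space \<Rightarrow> 'd::topological_space" and p
    using that by (simp add: continuous_on_eq_continuous_at continuous_at tendsto_at_iff_tendsto_nhds)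
  have near_G: "\<forall>\<^sub>F p in nhds (a, b). norm (hadamard_gradient D \<mu> p) < 1"
    using order_tendstoD(2)[OF filterlim_at[OF continuous_on_norm[OF contG], of "(a, b)"], of 1] F0 by simp
  have lim_x: "filterlim ?x (nhds s) (nhds (a, b))"
    using filterlim_at[OF continuous_on_vec_square_diff, of "(a, b)"] assms(6) by simp
  have proj_s: "active_proj s s = s"
    by (simp add: active_proj_def vec_eq_iff)
  have "continuous_on UNIV ?z"
  proof -
    have "continuous_on UNIV (\<lambda>p. if s $ i = 0 then 0 else ?x p $ i)" for i
      by (cases "s $ i = 0") (simp_all only: if_True if_False simp_thms continuous_on_const
          continuous_on_component continuous_on_vec_square_diff)
    then show ?thesis
      unfolding active_proj_def by (rule continuous_on_vec_lambda)
  qed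
  then have lim_z: "filterlim ?z (nhds s) (nhds (a, b))"
    using filterlim_at[of ?z "(a, b)"] proj_s assms(6) by simp
  have ball: "\<forall>\<^sub>F x in nhds s. x \<in> cball s 1"
    by (auto simp: eventually_nhds_metric dist_commute intro!: exI[of _ 1])
  have near_f: "\<forall>\<^sub>F x in nhds s. f x - f s < r"
  proof -
    have "continuous_on UNIV h"
      using D by (auto simp: gderiv_def continuous_on_eq_continuous_at intro: has_derivative_continuous)
    then have "continuous_on UNIV (\<lambda>x. f x - f s)"
      unfolding assms(3) l1norm_def by (intro continuous_intros)
    from order_tendstoD(2)[OF filterlim_at[OF this, of s], of r] \<open>r > 0\<close> show ?thesis by simp
  qed
  have near_inactive: "\<forall>\<^sub>F x in nhds s. \<forall>i. s $ i = 0 \<longrightarrow> \<bar>D x $ i\<bar> < \<mu>"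
  proof (rule eventually_all_finite)
    fix i
    have "((\<lambda>x. \<bar>D x $ i\<bar>) \<longlongrightarrow> \<bar>D s $ i\<bar>) (nhds s)"
      by (intro tendsto_intros filterlim_at contD)
    then show "\<forall>\<^sub>F x in nhds s. s $ i = 0 \<longrightarrow> \<bar>D x $ i\<bar> < \<mu>"
      using order_tendstoD(2)[OF _ inactive[of i]] by (cases "s $ i = 0") auto
  qed
  have near_active: "\<forall>\<^sub>F x in nhds s. \<forall>i. s $ i \<noteq> 0 \<longrightarrow> sgn (x $ i) = sgn (s $ i)"
  proof (rule eventually_all_finite)
    fix i
    have "((\<lambda>x. x $ i) \<longlongrightarrow> s $ i) (nhds s)"
      by (intro tendsto_vec_nth) (simp add: filterlim_ident)
    from order_tendstoD[OF this, of 0]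
    show "\<forall>\<^sub>F x in nhds s. s $ i \<noteq> 0 \<longrightarrow> sgn (x $ i) = sgn (s $ i)"
      by (cases "s $ i" "0::real" rule: linorder_cases) (auto elim: eventually_mono)
  qed
  define K where "K = (M + 2 * \<mu>) * ?N / \<kappa>\<^sup>2"
  define K' where "K' = ?N * (1 + L * ?N / \<kappa>) / \<kappa>"
  have K: "K \<ge> 0" "K' > 0"
    using LM(1,2) \<open>\<mu> > 0\<close> \<open>\<kappa> > 0\<close> by (auto simp: K_def K'_def intro!: mult_pos_pos divide_pos_pos add_pos_nonneg)
  let ?B = "sqrt (2 * K) + 2 * (C * K')"
  have "\<bar>(a $ i)\<^sup>2 - (b $ i)\<^sup>2\<bar> \<le> (a $ i)\<^sup>2 + (b $ i)\<^sup>2" for i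
    using zero_le_power2[of "a $ i"] zero_le_power2[of "b $ i"] by linarith
  \<comment> \<open>This bounds \<open>F p - F (a, b)\<close> by \<open>F p - f s\<close>, so that
    the KL inequality of \<open>f\<close> at \<open>s\<close> applies.\<close>
  then have Fs: "f s \<le> F (a, b)"
    using \<open>\<mu> > 0\<close> unfolding assms(3,4,6) l1norm_def
    by (auto simp: vec_square_def intro!: sum_mono)
  have near_z: "\<forall>\<^sub>F x in nhds s. x \<in> cball s 1 \<and> f x - f s < r \<and>
      (\<forall>i. s $ i = 0 \<longrightarrow> \<bar>D x $ i\<bar> < \<mu>) \<and> (\<forall>i. s $ i \<noteq> 0 \<longrightarrow> sgn (x $ i) = sgn (s $ i)) \<and>
      (\<forall>w\<in>limiting_subdifferential (\<lambda>x. ereal (f x)) x.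
         0 < f x - f s \<longrightarrow> f x - f s < r \<longrightarrow> (f x - f s) powr \<alpha> \<le> C * norm w)"
    by (intro eventually_conj ball near_f near_inactive near_active KL)
  \<comment> \<open>The range 1 serves the assumption \<open>t < 1\<close> of
    \<open>powr_max_half_bound\<close>.\<close>
  have "\<forall>\<^sub>F p in nhds (a, b). 0 < F p - F (a, b) \<longrightarrow> F p - F (a, b) < 1 \<longrightarrow>
     (F p - F (a, b)) powr max \<alpha> (1/2) \<le> ?B * norm (hadamard_gradient D \<mu> p)"
    using \<kappa> near_G eventually_compose_filterlim[OF ball lim_x] eventually_compose_filterlim[OF near_z lim_z]
  proof eventually_elim
    case (elim p)
    show ?case
    proof (intro impI)
      assume d: "0 < F p - F (a, b)" "F p - F (a, b) < 1"
      \<comment> \<open>An element of the subdifferential of \<open>f\<close> at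
        \<open>?z p\<close>. Off the support \<open>?z p\<close> vanishes and
        \<open>\<bar>D (?z p) $ i\<bar> < \<mu>\<close>, so the l1 term can cancel the gradient; on
        the support the signs of \<open>?z p\<close> and \<open>s\<close> agree.\<close>
      define w where "w = (\<chi> i. if s $ i = 0 then 0 else D (?z p) $ i + \<mu> * sgn (s $ i))"
      have Fp: "F p = h (?x p) + \<mu> * (\<Sum>i\<in>UNIV. (fst p $ i)\<^sup>2 + (snd p $ i)\<^sup>2)"
        by (simp add: assms(4) case_prod_unfold)
      have est: "F p \<le> f (?z p) + K * (norm (hadamard_gradient D \<mu> p))\<^sup>2" "norm w \<le> K' * norm (hadamard_gradient D \<mu> p)"
        using hadamard_estimates[OF \<open>\<kappa> > 0\<close> \<open>\<mu> > 0\<close> LM(1,2), where D = D and a = "fst p" and b = "snd p" and s = s and h = h]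
          elim LM(3,4)[of "?x p" "?z p"]
        unfolding Fp assms(3) K_def K'_def w_def by auto
      have "w - D (?z p) \<in> convex_subdifferential (\<lambda>x. \<mu> * l1norm x) (?z p)"
      proof -
        define u where "u = (w - D (?z p)) /\<^sub>R \<mu>"
        have "u $ i * ?z p $ i = \<bar>?z p $ i\<bar> \<and> \<bar>u $ i\<bar> \<le> 1" for i
        proof (cases "s $ i = 0")
          case True
          then show ?thesis using elim \<open>\<mu> > 0\<close>
            by (auto simp: u_def w_def active_proj_def abs_mult field_simps dest!: spec[of _ i])
        next
          case False
          then have "u $ i = sgn (?z p $ i)"
            using elim \<open>\<mu> > 0\<close> by (simp add: u_def w_def)
          then show ?thesis by (simp add: abs_sgn mult.commute abs_sgn_eq)
        qed
        then have "u \<in> convex_subdifferential l1norm (?z p)"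
          by (simp add: convex_subdifferential_l1norm_iff)
        then have "\<mu> * (l1norm (?z p) + u \<bullet> (y - ?z p)) \<le> \<mu> * l1norm y" for y
          using \<open>\<mu> > 0\<close> by (simp add: convex_subdifferential_def)
        moreover have "w - D (?z p) = \<mu> *\<^sub>R u"
          using \<open>\<mu> > 0\<close> by (simp add: u_def)
        ultimately show ?thesis
          by (simp add: convex_subdifferential_def algebra_simps)
      qed
      from GDERIV_add_convex_subgradient[OF D this]
      have w: "w \<in> limiting_subdifferential (\<lambda>x. ereal (f x)) (?z p)"
        by (simp add: assms(3))
      have "(f (?z p) - f s) powr \<alpha> \<le> C * K' * norm (hadamard_gradient D \<mu> p)" if "0 < f (?z p) - f s"
      proof -
        have "(f (?z p) - f s) powr \<alpha> \<le> C * norm w"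
          using elim w that by blast
        also have "\<dots> \<le> C * (K' * norm (hadamard_gradient D \<mu> p))"
          using est(2) \<open>C > 0\<close> by simp
        finally show ?thesis by simp
      qed
      then show "(F p - F (a, b)) powr max \<alpha> (1/2) \<le> ?B * norm (hadamard_gradient D \<mu> p)"
        using d est(1) Fs K \<open>C > 0\<close> \<open>0 < \<alpha>\<close> \<open>\<alpha> < 1\<close>
        by (intro powr_max_half_bound[where d = "f (?z p) - f s"]) auto
    qed
  qed
  moreover have "?B > 0"
    using K \<open>C > 0\<close> by (intro add_nonneg_pos) auto
  ultimately show ?thesis
    using \<open>0 < \<alpha>\<close> \<open>\<alpha> < 1\<close> by (intro KL_property_C1I[OF GF contG, of _ ?B 1]) auto
qed

end
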